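(* Let $f:\mathbb{C}\to\mathbb{C}$ be a transcendental entire function with a logarithmic tract $D$. Then, given any positive sequence $(a_n)$ such that $a_n\to\infty$ as $n\to\infty$, there exist $$\zeta\in I(f)\cap J(f)\cap\overline{D}\quad\text{and}\quad N\in\mathbb{N}$$ such that $$f^n(\zeta)\in\overline{D}\quad\text{for all } n\geq 1,$$ and $$|f^n(\zeta)|\leq a_n\quad\text{for all } n\geq N.$$
   Context: $f^n$ denotes the $n$th iterate of $f$, and $\mathbb{N}$ denotes the non-negative integers. The Fatou set $F(f)$ is the subset of $\mathbb{C}$ where the iterates $(f^n)$ form a normal family, and the Julia set is $J(f)=\mathbb{C}\setminus F(f)$. The escaping set is $I(f)=\{z: f^n(z)\to\infty \text{ as } n\to\infty\}$. Direct tract: let $D$ be an unbounded domain in $\mathbb{C}$ whose boundary consists of piecewise smooth curves and whose complement is unbounded. Let $f$ be a complex valued function whose domain of definition contains the closure $\overline{D}$. Then $D$ is a direct tract of $f$ if $f$ is holomorphic in $D$, continuous in $\overline{D}$, and there exists $R>0$ such that $|f(z)|=R$ for $z\in\partial D$ while $|f(z)|>R$ for $z\in D$. If, in addition, the restriction $f:D\to\{z\in\mathbb{C}:|z|>R\}$ is a universal covering, then $D$ is a logarithmic tract of $f$. *)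

theory Defs
  imports "HOL-Complex_Analysis.Complex_Analysis"
begin

definition transcendental_entire :: "(complex \<Rightarrow> complex) \<Rightarrow> bool" where
  "transcendental_entire f \<longleftrightarrow>
     f holomorphic_on UNIV \<and> \<not> (\<exists>p :: complex poly. \<forall>z. f z = poly p z)"

(* Locally uniform convergence to the constant infinity is allowed as a limit.  On a domain U and
   for holomorphic families, this is the usual notion (spherical locally uniform convergence). *)
definition normal_family_on :: "complex set \<Rightarrow> (complex \<Rightarrow> complex) set \<Rightarrow> bool" where
  "normal_family_on U F \<longleftrightarrow>
     (\<forall>s :: nat \<Rightarrow> complex \<Rightarrow> complex. range s \<subseteq> F \<longrightarrow>
       (\<exists>r :: nat \<Rightarrow> nat. strict_mono r \<and>
         ((\<exists>g. \<forall>K. compact K \<and> K \<subseteq> U \<longrightarrow>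
              uniform_limit K (\<lambda>n. s (r n)) g sequentially) \<or>
          (\<forall>K. compact K \<and> K \<subseteq> U \<longrightarrow>
              (\<forall>B :: real. \<forall>\<^sub>F n in sequentially. \<forall>z\<in>K. B < norm (s (r n) z))))))"

definition fatou_set :: "(complex \<Rightarrow> complex) \<Rightarrow> complex set" where
  "fatou_set f =
     {z. \<exists>U. open U \<and> connected U \<and> z \<in> U \<and> normal_family_on U (range (\<lambda>n. f ^^ n))}"

definition julia_set :: "(complex \<Rightarrow> complex) \<Rightarrow> complex set" where
  "julia_set f = - fatou_set f"

definition escaping_set :: "(complex \<Rightarrow> complex) \<Rightarrow> complex set" where
  "escaping_set f = {z. filterlim (\<lambda>n. (f ^^ n) z) at_infinity sequentially}"

(* Nonvanishing of the derivative is required because valid_path alone admits constant paths. *)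
definition piecewise_smooth_path :: "(real \<Rightarrow> complex) \<Rightarrow> bool" where
  "piecewise_smooth_path g \<longleftrightarrow>
     path g \<and>
     (\<exists>S. finite S \<and> g C1_differentiable_on ({0..1} - S) \<and>
          (\<forall>t \<in> {0..1} - S. vector_derivative g (at t) \<noteq> 0))"

(* The boundary curves may be unbounded and infinitely many, so they are cut into compact arcs;
   local finiteness keeps the arcs from accumulating at a point of the plane. *)
definition piecewise_smooth_boundary :: "complex set \<Rightarrow> bool" where
  "piecewise_smooth_boundary D \<longleftrightarrow>
     (\<exists>\<Gamma>. (\<forall>g\<in>\<Gamma>. piecewise_smooth_path g) \<and>
          locally_finite_in euclidean (path_image ` \<Gamma>) \<and>
          frontier D = (\<Union>g\<in>\<Gamma>. path_image g))"

definition direct_tract_at :: "real \<Rightarrow> (complex \<Rightarrow> complex) \<Rightarrow> complex set \<Rightarrow> bool" where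
  "direct_tract_at R f D \<longleftrightarrow>
     open D \<and> connected D \<and> \<not> bounded D \<and> \<not> bounded (- D) \<and> piecewise_smooth_boundary D \<and>
     f holomorphic_on D \<and> continuous_on (closure D) f \<and>
     0 < R \<and> (\<forall>z\<in>frontier D. norm (f z) = R) \<and> (\<forall>z\<in>D. R < norm (f z))"

definition direct_tract :: "(complex \<Rightarrow> complex) \<Rightarrow> complex set \<Rightarrow> bool" where
  "direct_tract f D \<longleftrightarrow> (\<exists>R. direct_tract_at R f D)"

(* A universal covering is a covering by a simply connected space. *)
definition logarithmic_tract :: "(complex \<Rightarrow> complex) \<Rightarrow> complex set \<Rightarrow> bool" where
  "logarithmic_tract f D \<longleftrightarrow>
     (\<exists>R. direct_tract_at R f D \<and> covering_space D f {w. R < norm w} \<and> simply_connected D)"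

end

theory Submission
  imports Defs
begin

text \<open>
  Since \<open>f\<close> restricted to the tract and the exponential map are both universal coverings of
  the exterior of a disc, there is a conformal map \<open>\<Phi>\<close> from a right half-plane \<open>Re w > c\<close> into the
  tract with \<open>f (\<Phi> w) = exp w\<close>.  Enlarging the disc so that its radius exceeds \<open>|f 0|\<close> keeps \<open>0\<close> out
  of the image, so that \<open>\<Phi> = exp \<circ> F\<close> for a holomorphic \<open>F\<close>.  The orbit of a point under \<open>f\<close> then
  corresponds to a sequence \<open>w n\<close> with \<open>exp (F (w (n + 1))) = exp (w n)\<close>, and the modulus of the
  \<open>(n + 1)\<close>-st iterate is \<open>exp (Re (w n))\<close>.

  Everything rests on one estimate, due to Eremenko and Lyubich in spirit: since \<open>exp \<circ> F\<close> is
  injective, the image of \<open>F\<close> contains no disc of radius greater than \<open>\<pi>\<close>, and Bloch's theorem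
  yields \<open>|F' w| \<le> 12 \<pi> / (Re w - c)\<close> (\<open>deriv_log_bound\<close>).  It is used three times.

  First, integrated along the real axis, it shows that \<open>Re (F x) \<le> x\<close> for large real \<open>x\<close>.  As \<open>Re F\<close>
  is unbounded above on each vertical line, every real number above \<open>Re (F x)\<close> is a value of \<open>Re F\<close>
  on the line \<open>Re w = x\<close> (\<open>vertical_line_hits_level\<close>): the orbit may climb as slowly as desired.

  Second, \<open>F\<close> is a strong contraction far to the right, so that a rectangle of width \<open>2\<close> and height
  \<open>2 \<pi>\<close> is mapped by \<open>F\<close> into a vertical strip of width \<open>2\<close>, whereas \<open>exp\<close> maps a rectangle of that
  size, placed anywhere in such a strip, onto the same annulus as the strip.  For any sequence of
  heights \<open>\<alpha>\<close> that rises by at most \<open>1\<close> in each step, one can therefore choose rectangles over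
  \<open>[\<alpha> n, \<alpha> n + 2]\<close> such that the \<open>f\<close>-image of the \<open>n\<close>-th set \<open>\<Phi> ` Q n\<close> covers the next one.  A
  compactness argument gives a point whose orbit follows these sets
  (\<open>orbit_with_prescribed_growth\<close>).  Choosing \<open>\<alpha>\<close> to tend to infinity below \<open>ln (a (n + 1)) - 2\<close>
  gives the required slow escape.

  Third, it makes \<open>f\<close> expanding in the metric \<open>|dz| / |z|\<close> on the tract: the logarithmic derivative
  of the \<open>n\<close>-th iterate along such an orbit grows geometrically, even relative to \<open>ln |f^n|\<close>.  On
  a Fatou neighbourhood of an escaping point some subsequence of the iterates would tend to
  infinity uniformly, and the Schwarz--Pick lemma applied to the logarithm of an iterate, which takes
  values in a half-plane, bounds the same quantity.  Hence the point lies in the Julia set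
  (\<open>escaping_orbit_in_julia_set\<close>).
\<close>

section \<open>Holomorphic functions and logarithms\<close>

lemma log_expression_differs_by_constant:
  fixes g h :: "complex \<Rightarrow> complex"
  assumes "connected S" "continuous_on S g" "continuous_on S h"
    and eq: "\<And>w. w \<in> S \<Longrightarrow> exp (g w) = exp (h w)"
  obtains k where "\<And>w. w \<in> S \<Longrightarrow> g w = h w + k"
proof -
  have "(\<lambda>w. g w - h w) constant_on S"
  proof (rule continuous_discrete_range_constant[OF assms(1)])
    show "continuous_on S (\<lambda>w. g w - h w)"
      using assms by (intro continuous_intros)
    fix x assume x: "x \<in> S"
    show "\<exists>e>0. \<forall>y. y \<in> S \<and> g y - h y \<noteq> g x - h x \<longrightarrow> e \<le> norm (g y - h y - (g x - h x))"
    proof (intro exI conjI allI impI)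
      show "0 < 2 * pi" by simp
      fix y assume y: "y \<in> S \<and> g y - h y \<noteq> g x - h x"
      have "exp (g y - h y) = exp (g x - h x)"
        using x y eq by (simp add: exp_diff)
      then have "\<not> \<bar>Im (g y - h y) - Im (g x - h x)\<bar> < 2 * pi"
        using y exp_complex_eqI by blast
      then show "2 * pi \<le> norm (g y - h y - (g x - h x))"
        using abs_Im_le_cmod[of "g y - h y - (g x - h x)"] by simp
    qed
  qed
  then obtain k where "\<And>w. w \<in> S \<Longrightarrow> g w - h w = k"
    unfolding constant_on_def by blast
  then show ?thesis using that[of k] by (metis add.commute diff_add_cancel)
qed

text \<open>
  A continuous right inverse of a holomorphic function, here up to a translation, is injective and
  hence open by invariance of domain; it is therefore a restriction of the holomorphic inverse.
  This turns the purely topological lift given by covering theory into a conformal map.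
\<close>

lemma holomorphic_right_inverse:
  fixes \<phi> \<Phi> :: "complex \<Rightarrow> complex"
  assumes "open S" "continuous_on S \<Phi>" "open D" "\<Phi> ` S \<subseteq> D" "\<phi> holomorphic_on D"
    and inv: "\<And>w. w \<in> S \<Longrightarrow> \<phi> (\<Phi> w) = w + k"
  shows "\<Phi> holomorphic_on S"
proof -
  have inj: "inj_on \<Phi> S"
    using inv by (metis add_right_cancel inj_onI)
  have op: "open (\<Phi> ` S)"
    using assms inj invariance_of_domain by blast
  have hol: "\<phi> holomorphic_on \<Phi> ` S"
    using assms holomorphic_on_subset by blast
  have "inj_on \<phi> (\<Phi> ` S)"
    using inv by (auto simp: inj_on_def)
  then obtain g where g: "g holomorphic_on \<phi> ` \<Phi> ` S" "\<And>z. z \<in> \<Phi> ` S \<Longrightarrow> g (\<phi> z) = z"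
    using holomorphic_has_inverse[OF hol op] by metis
  have "(g \<circ> (\<lambda>w. w + k)) holomorphic_on S"
  proof (rule holomorphic_on_compose_gen)
    show "(\<lambda>w. w + k) holomorphic_on S" by (intro holomorphic_intros)
    show "g holomorphic_on \<phi> ` \<Phi> ` S" by (rule g)
    show "(\<lambda>w. w + k) ` S \<subseteq> \<phi> ` \<Phi> ` S"
    proof
      fix v assume "v \<in> (\<lambda>w. w + k) ` S"
      then obtain w where "w \<in> S" "v = \<phi> (\<Phi> w)" using inv by auto
      then show "v \<in> \<phi> ` \<Phi> ` S" by blast
    qed
  qed
  moreover have "(g \<circ> (\<lambda>w. w + k)) w = \<Phi> w" if "w \<in> S" for w
    using g(2)[of "\<Phi> w"] inv that by simp
  ultimately show ?thesis
    using holomorphic_transform by blast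
qed

text \<open>
  If the image of \<open>F\<close> contained a disc of radius greater than \<open>\<pi>\<close>, it would contain two points that
  differ by \<open>2 \<pi> \<i>\<close>, on which the exponential agrees.  Bloch's theorem, with its constant \<open>1/12\<close>,
  converts the absence of such a disc into a bound for the derivative.
\<close>

lemma deriv_bound_if_exp_comp_inj:
  fixes F :: "complex \<Rightarrow> complex"
  assumes hol: "F holomorphic_on ball w r" and "0 < r"
    and inj: "inj_on (\<lambda>u. exp (F u)) (ball w r)"
  shows "norm (deriv F w) \<le> 12 * pi / r"
proof (rule ccontr)
  assume "\<not> ?thesis"
  then have gt: "pi < r * norm (deriv F w) / 12"
    using \<open>0 < r\<close> by (simp add: field_simps)
  obtain b where b: "ball b (r * norm (deriv F w) / 12) \<subseteq> F ` ball w r"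
    using Bloch[OF hol \<open>0 < r\<close>] by blast
  have "b + \<i> * pi \<in> ball b (r * norm (deriv F w) / 12)" "b - \<i> * pi \<in> ball b (r * norm (deriv F w) / 12)"
    using gt by (simp_all add: dist_norm norm_mult)
  then have "b + \<i> * pi \<in> F ` ball w r" "b - \<i> * pi \<in> F ` ball w r"
    using b by blast+
  then obtain u v where u: "u \<in> ball w r" "F u = b + \<i> * pi"
    and v: "v \<in> ball w r" "F v = b - \<i> * pi"
    by (metis imageE)
  have "exp (F u) = exp (F v)"
    using u v by (simp add: exp_add exp_diff)
  then have "u = v" using inj_onD[OF inj _ u(1) v(1)] by simp
  then have "\<i> * complex_of_real pi = 0" using u v by (simp add: algebra_simps)
  then show False by simp
qed

text \<open>
  The Schwarz--Pick inequality at the centre of a disc, obtained from the Schwarz lemma by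
  composing with the Cayley transform of the half-plane that sends \<open>h z\<close> to \<open>0\<close>.
\<close>

lemma deriv_bound_right_half_plane:
  fixes h :: "complex \<Rightarrow> complex"
  assumes hol: "h holomorphic_on ball z \<delta>" and "0 < \<delta>"
    and pos: "\<And>u. u \<in> ball z \<delta> \<Longrightarrow> 0 < Re (h u)"
  shows "norm (deriv h z) \<le> 2 * Re (h z) / \<delta>"
proof -
  define a where "a = h z"
  have a: "0 < Re a" using pos \<open>0 < \<delta>\<close> by (simp add: a_def)
  define g where "g = (\<lambda>u. h (z + of_real \<delta> * u))"
  define k where "k = (\<lambda>u. (g u - a) / (g u + cnj a))"
  have in_ball: "z + of_real \<delta> * u \<in> ball z \<delta>" if "norm u < 1" for u
    using that \<open>0 < \<delta>\<close> by (simp add: dist_norm norm_mult)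
  have g_hol: "g holomorphic_on ball 0 1"
  proof -
    have "(h \<circ> (\<lambda>u. z + of_real \<delta> * u)) holomorphic_on ball 0 1"
      using in_ball by (intro holomorphic_on_compose_gen[OF _ hol] holomorphic_intros) auto
    then show ?thesis by (simp add: g_def o_def)
  qed
  have g_pos: "0 < Re (g u)" if "norm u < 1" for u
    using pos in_ball that by (simp add: g_def)
  have nz: "g u + cnj a \<noteq> 0" if "norm u < 1" for u
  proof
    assume "g u + cnj a = 0"
    then have "Re (g u + cnj a) = 0" by simp
    then show False using g_pos[OF that] a by simp
  qed
  have k_hol: "k holomorphic_on ball 0 1"
    unfolding k_def using g_hol nz by (intro holomorphic_intros) auto
  have k0: "k 0 = 0" by (simp add: k_def g_def a_def)
  have k_lt: "norm (k u) < 1" if "norm u < 1" for u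
  proof -
    have "(norm (g u + cnj a))\<^sup>2 - (norm (g u - a))\<^sup>2 = 4 * Re (g u) * Re a"
      unfolding cmod_power2 by (simp add: power2_eq_square algebra_simps)
    moreover have "0 < 4 * Re (g u) * Re a"
      using g_pos[OF that] a by simp
    ultimately have "(norm (g u - a))\<^sup>2 < (norm (g u + cnj a))\<^sup>2" by linarith
    then have "norm (g u - a) < norm (g u + cnj a)"
      using power_less_imp_less_base norm_ge_zero by blast
    then show ?thesis
      using nz[OF that] by (simp add: k_def norm_divide divide_simps)
  qed
  have "norm (deriv k 0) \<le> 1"
    using Schwarz_Lemma(2)[OF k_hol k0 k_lt, of 0] by simp
  moreover have "deriv k 0 = of_real \<delta> * deriv h z / (2 * of_real (Re a))"
  proof (rule DERIV_imp_deriv)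
    have "(h has_field_derivative deriv h z) (at (z + of_real \<delta> * 0))"
      using holomorphic_derivI[OF hol] \<open>0 < \<delta>\<close> by simp
    then have dg: "(g has_field_derivative deriv h z * of_real \<delta>) (at 0)"
      unfolding g_def by (rule DERIV_chain2) (auto intro!: derivative_eq_intros)
    have "a + cnj a = 2 * of_real (Re a)" by (simp add: complex_eq_iff)
    moreover have "a + cnj a \<noteq> 0" using a by (simp add: complex_eq_iff)
    moreover have "g 0 = a" by (simp add: g_def a_def)
    ultimately show "(k has_field_derivative of_real \<delta> * deriv h z / (2 * of_real (Re a))) (at 0)"
      unfolding k_def
      by (auto intro!: derivative_eq_intros dg simp: divide_simps)
  qed
  ultimately show ?thesis
    using a \<open>0 < \<delta>\<close> by (simp add: a_def norm_divide norm_mult divide_simps mult.commute)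
qed

lemma exp_preimage_in_strip:
  obtains v where "exp v = exp u" "Re v = Re u" "y \<le> Im v" "Im v \<le> y + 2 * pi"
proof -
  define k where "k = \<lfloor>(Im u - y) / (2 * pi)\<rfloor>"
  define v where "v = u - of_int (2 * k) * pi * \<i>"
  have "u = v + (of_int (2 * k) * pi) * \<i>" by (simp add: v_def)
  then have "exp v = exp u" using exp_eq by metis
  moreover have "of_int k \<le> (Im u - y) / (2 * pi)" "(Im u - y) / (2 * pi) < of_int k + 1"
    unfolding k_def by linarith+
  then have "y \<le> Im v" "Im v \<le> y + 2 * pi"
    by (simp_all add: v_def field_simps)
  moreover have "Re v = Re u" by (simp add: v_def)
  ultimately show ?thesis using that by blast
qed

lemma holomorphic_on_iterate:
  assumes "f holomorphic_on UNIV"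
  shows "(f ^^ n) holomorphic_on UNIV"
proof (induction n)
  case (Suc n)
  then show ?case
    using holomorphic_on_compose[OF Suc holomorphic_on_subset[OF assms]]
    by (simp only: funpow.simps subset_UNIV)
qed (simp add: id_def)

section \<open>Orbits through a sequence of compact sets\<close>

text \<open>
  For each \<open>n\<close> the covering property yields points whose orbit visits \<open>E 0, \<dots>, E n\<close>: pull a point of
  \<open>E n\<close> back step by step.  The sets of such points are compact and decreasing, so they have a
  common element.
\<close>

lemma exists_orbit_through_compact_sets:
  fixes f :: "'a::heine_borel \<Rightarrow> 'a" and E :: "nat \<Rightarrow> 'a set"
  assumes cont: "continuous_on UNIV f"
    and comp: "\<And>n. compact (E n)" and ne: "\<And>n. E n \<noteq> {}"
    and cover: "\<And>n. E (Suc n) \<subseteq> f ` E n"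
  obtains \<zeta> where "\<And>n. (f ^^ n) \<zeta> \<in> E n"
proof -
  have cont_it: "continuous_on UNIV (f ^^ n)" for n
  proof (induction n)
    case (Suc n)
    then show ?case
      using continuous_on_compose[of UNIV "f ^^ n" f] cont continuous_on_subset by (auto simp: o_def)
  qed (auto simp: id_def)
  define K where "K n = (\<Inter>k\<in>{..n}. (f ^^ k) -` E k)" for n
  have closed: "closed (K n)" for n
    unfolding K_def using comp cont_it
    by (intro closed_INT ballI closed_vimage compact_imp_closed) auto
  have sub: "K n \<subseteq> E 0" for n by (force simp: K_def)
  have onto: "\<exists>x\<in>K n. (f ^^ n) x = y" if "y \<in> E n" for n y
    using that
  proof (induction n arbitrary: y)
    case 0
    then show ?case by (auto simp: K_def)
  next
    case (Suc n)
    then obtain y' where "y' \<in> E n" "f y' = y" using cover by blast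
    then obtain x where "x \<in> K n" "(f ^^ n) x = y'" using Suc.IH by blast
    then have "x \<in> K (Suc n)" "(f ^^ Suc n) x = y"
      using \<open>f y' = y\<close> Suc.prems by (auto simp: K_def le_Suc_eq)
    then show ?case by blast
  qed
  have "\<Inter> (range K) \<noteq> {}"
  proof (rule compact_nest)
    show "compact (K n)" for n
      using closed sub comp by (metis closed_Int_compact inf.absorb_iff1)
    show "K n \<noteq> {}" for n using onto ne by blast
    show "K n \<subseteq> K m" if "m \<le> n" for m n using that by (auto simp: K_def)
  qed
  then obtain \<zeta> where "\<And>n. \<zeta> \<in> K n" by blast
  then have "(f ^^ n) \<zeta> \<in> E n" for n by (force simp: K_def)
  then show ?thesis by (rule that)
qed

section \<open>Logarithmic coordinates on a tract\<close>

text \<open>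
  The data of a logarithmic tract in the form in which they are used: the conformal parametrization
  \<open>\<Phi>\<close> of (part of) the tract by a half-plane and a branch \<open>F\<close> of its logarithm.  The last assumption
  records that the curve in the tract on which \<open>|f| = exp t\<close> is unbounded.
\<close>

locale tract_coordinate =
  fixes f \<Phi> F :: "complex \<Rightarrow> complex" and c :: real
  assumes entire: "f holomorphic_on UNIV"
    and log_hol: "F holomorphic_on {w. c < Re w}"
    and exp_log: "\<And>w. c < Re w \<Longrightarrow> exp (F w) = \<Phi> w"
    and semiconj: "\<And>w. c < Re w \<Longrightarrow> f (\<Phi> w) = exp w"
    and inj: "inj_on \<Phi> {w. c < Re w}"
    and level_unbounded: "\<And>t B. c < t \<Longrightarrow> \<exists>y\<ge>0. B < norm (\<Phi> (Complex t y))"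

text \<open>
  The map \<open>\<Phi>\<close> is the lift of \<open>exp\<close> through the covering \<open>f\<close>, and a logarithm \<open>\<phi>\<close> of \<open>f\<close> on the simply
  connected tract inverts it up to a translation.  Level curves leave every disc because the points
  of a disc that lie in the closed tract and satisfy \<open>|f z| = exp t\<close> stay off the boundary; they
  form a compact subset of the tract, on which \<open>\<phi>\<close> is bounded.
\<close>

lemma logarithmic_tract_coordinate:
  assumes ent: "f holomorphic_on UNIV" and tract: "logarithmic_tract f D"
  obtains \<Phi> F c where "tract_coordinate f \<Phi> F c" "\<And>w. c < Re w \<Longrightarrow> \<Phi> w \<in> D"
proof -
  obtain R where "direct_tract_at R f D" and cov: "covering_space D f {w. R < norm w}"
    and sc: "simply_connected D"
    using tract unfolding logarithmic_tract_def by blast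
  then have oD: "open D" and holD: "f holomorphic_on D" and R: "0 < R"
    and bd: "\<And>z. z \<in> frontier D \<Longrightarrow> norm (f z) = R" and gt: "\<And>z. z \<in> D \<Longrightarrow> R < norm (f z)"
    unfolding direct_tract_at_def by auto
  \<comment> \<open>Adding \<open>|f 0|\<close> to the radius ensures that \<open>\<Phi>\<close> omits \<open>0\<close> and so has a logarithm.\<close>
  define c where "c = ln (R + norm (f 0))"
  define H where "H = {w. c < Re w}"
  have big: "R + norm (f 0) < norm (exp w)" if "w \<in> H" for w
  proof -
    have "exp c < exp (Re w)" using that by (simp add: H_def)
    moreover have "exp c = R + norm (f 0)" using R by (simp add: c_def add_pos_nonneg)
    ultimately show ?thesis by simp
  qed
  have H: "convex H" "open H" unfolding H_def
    by (auto simp: convex_halfspace_Re_gt open_halfspace_Re_gt)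
  obtain \<Phi> where cont: "continuous_on H \<Phi>" and \<Phi>D: "\<Phi> \<in> H \<rightarrow> D"
    and f\<Phi>: "\<And>w. w \<in> H \<Longrightarrow> f (\<Phi> w) = exp w"
  proof (rule covering_space_lift[OF cov, of H exp])
    show "simply_connected H" "locally path_connected H"
      using H convex_imp_simply_connected open_imp_locally_path_connected by auto
    show "exp \<in> H \<rightarrow> {w. R < norm w}"
    proof
      fix w assume "w \<in> H"
      then show "exp w \<in> {w. R < norm w}"
        using big[of w] norm_ge_zero[of "f 0"] unfolding mem_Collect_eq by linarith
    qed
  qed (auto intro: continuous_intros)
  have nzD: "f z \<noteq> 0" if "z \<in> D" for z using gt[OF that] R by auto
  obtain \<phi> where \<phi>: "\<phi> holomorphic_on D" "\<And>z. z \<in> D \<Longrightarrow> f z = exp (\<phi> z)"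
    using simply_connected_imp_holomorphic_log[OF holD sc open_imp_locally_path_connected[OF oD] nzD]
    by blast
  have cont\<phi>: "continuous_on D \<phi>" using \<phi> holomorphic_on_imp_continuous_on by blast
  obtain k where k: "\<And>w. w \<in> H \<Longrightarrow> \<phi> (\<Phi> w) = w + k"
  proof (rule log_expression_differs_by_constant[of H "\<lambda>w. \<phi> (\<Phi> w)" "\<lambda>w. w"])
    show "continuous_on H (\<lambda>w. \<phi> (\<Phi> w))"
      using continuous_on_compose2[OF cont\<phi> cont] \<Phi>D by auto
    show "exp (\<phi> (\<Phi> w)) = exp w" if "w \<in> H" for w
      using that \<phi>(2)[of "\<Phi> w"] f\<Phi>[OF that] \<Phi>D by (auto dest: funcset_mem)
  qed (use H convex_connected in auto)
  have \<Phi>hol: "\<Phi> holomorphic_on H"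
    using holomorphic_right_inverse[OF H(2) cont oD _ \<phi>(1) k] \<Phi>D by auto
  have "\<Phi> w \<noteq> 0" if "w \<in> H" for w
    using big[OF that] f\<Phi>[OF that] R by auto
  then obtain F where F: "F holomorphic_on H" "\<And>w. w \<in> H \<Longrightarrow> \<Phi> w = exp (F w)"
    using contractible_imp_holomorphic_log[OF \<Phi>hol convex_imp_contractible[OF H(1)]] by blast
  have "tract_coordinate f \<Phi> F c"
  proof
    show "inj_on \<Phi> {w. c < Re w}"
      unfolding H_def[symmetric] by (rule inj_onI) (metis k add_right_cancel)
    fix t B assume t: "c < t"
    show "\<exists>y\<ge>0. B < norm (\<Phi> (Complex t y))"
    proof (rule ccontr)
      assume neg: "\<not> ?thesis"
      have tH: "Complex t y \<in> H" for y using t by (simp add: H_def)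
      define K where "K = cball 0 B \<inter> (closure D \<inter> {z. norm (f z) = exp t})"
      have contf: "continuous_on UNIV f" using ent holomorphic_on_imp_continuous_on by blast
      have "closed {z. norm (f z) = exp t}"
        by (intro closed_Collect_eq continuous_intros contf)
      then have "compact K"
        unfolding K_def by (intro compact_Int_closed closed_Int) auto
      moreover have KD: "K \<subseteq> D"
      proof
        fix z assume z: "z \<in> K"
        have "R < norm (f z)"
          using big[OF tH, of 0] z norm_ge_zero[of "f 0"] by (simp add: K_def del: norm_ge_zero)
        then have "z \<notin> frontier D" using bd by force
        then show "z \<in> D" using z oD by (simp add: K_def frontier_def interior_open)
      qed
      ultimately have "bounded (\<phi> ` K)"
        using compact_continuous_image[of K \<phi>] cont\<phi> continuous_on_subset compact_imp_bounded by blast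
      then obtain M where M: "\<And>z. z \<in> K \<Longrightarrow> norm (\<phi> z) \<le> M"
        by (auto simp: bounded_iff)
      define y where "y = \<bar>M\<bar> + \<bar>Im k\<bar> + 1"
      have "y \<ge> 0" by (simp add: y_def)
      then have "norm (\<Phi> (Complex t y)) \<le> B" using neg by force
      moreover have "\<Phi> (Complex t y) \<in> closure D"
        using \<Phi>D tH closure_subset by blast
      ultimately have "\<Phi> (Complex t y) \<in> K"
        using f\<Phi>[OF tH] by (simp add: K_def)
      then have "norm (Complex t y + k) \<le> M" using M k[OF tH] by force
      moreover have "\<bar>y + Im k\<bar> \<le> norm (Complex t y + k)"
        using abs_Im_le_cmod[of "Complex t y + k"] by simp
      ultimately show False by (simp add: y_def)
    qed
  qed (use ent F f\<Phi> H_def in auto)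
  moreover have "\<Phi> w \<in> D" if "c < Re w" for w using that \<Phi>D by (auto simp: H_def)
  ultimately show ?thesis using that by blast
qed


section \<open>Slowly growing sequences\<close>

text \<open>
  The sequence follows \<open>b\<close> but rises by at most \<open>1\<close> per step.  It is free to drop
  by any amount when \<open>b\<close> does; only upward steps are restricted.
\<close>

lemma slow_sequence_above_level:
  fixes b :: "nat \<Rightarrow> real"
  assumes b: "filterlim b at_top sequentially"
  obtains \<alpha> :: "nat \<Rightarrow> real"
  where "\<And>n. A \<le> \<alpha> n" "\<And>n. \<alpha> (Suc n) \<le> \<alpha> n + 1" "filterlim \<alpha> at_top sequentially"
    "\<forall>\<^sub>F n in sequentially. \<alpha> n \<le> b n"
proof -
  define \<alpha> where "\<alpha> = rec_nat A (\<lambda>n x. max A (min (b (Suc n)) (x + 1)))"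
  have \<alpha>_0: "\<alpha> 0 = A" and \<alpha>_Suc: "\<alpha> (Suc n) = max A (min (b (Suc n)) (\<alpha> n + 1))" for n
    by (simp_all add: \<alpha>_def)
  have ge: "A \<le> \<alpha> n" for n by (cases n) (simp_all add: \<alpha>_0 \<alpha>_Suc)
  have step: "\<alpha> (Suc n) \<le> \<alpha> n + 1" for n using ge[of n] by (simp add: \<alpha>_Suc)
  have lim: "filterlim \<alpha> at_top sequentially"
    unfolding filterlim_at_top
  proof
    fix Z
    have "\<forall>\<^sub>F n in sequentially. Z \<le> b n"
      using b by (simp add: filterlim_at_top)
    then obtain N where N: "\<And>n. N \<le> n \<Longrightarrow> Z \<le> b n" by (auto simp: eventually_sequentially)
    have climb: "min Z (A + real k) \<le> \<alpha> (N + k)" for k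
    proof (induction k)
      case 0
      then show ?case using ge[of N] by simp
    next
      case (Suc k)
      then show ?case using N[of "Suc (N + k)"] by (auto simp: \<alpha>_Suc)
    qed
    obtain k0 :: nat where k0: "Z - A \<le> real k0" using real_arch_simple by blast
    have "Z \<le> \<alpha> n" if "N + k0 \<le> n" for n
      using climb[of "n - N"] that k0 by (auto simp: of_nat_diff)
    then show "\<forall>\<^sub>F n in sequentially. Z \<le> \<alpha> n"
      by (auto simp: eventually_sequentially)
  qed
  have "\<forall>\<^sub>F n in sequentially. A \<le> b n"
    using b by (simp add: filterlim_at_top)
  moreover have "\<forall>\<^sub>F n in sequentially. 0 < n" by (rule eventually_gt_at_top)
  ultimately have "\<forall>\<^sub>F n in sequentially. \<alpha> n \<le> b n"
  proof eventually_elim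
    case (elim n)
    then obtain m where "n = Suc m" using gr0_implies_Suc by blast
    then show ?case using elim by (simp add: \<alpha>_Suc)
  qed
  then show ?thesis using that ge step lim by blast
qed

section \<open>Contraction of the logarithmic inverse and slow orbits\<close>

context tract_coordinate
begin

lemma deriv_log_bound:
  assumes w: "c < Re w"
  shows "norm (deriv F w) \<le> 12 * pi / (Re w - c)"
proof (rule deriv_bound_if_exp_comp_inj)
  have sub: "ball w (Re w - c) \<subseteq> {w. c < Re w}"
  proof
    fix u assume "u \<in> ball w (Re w - c)"
    then have "norm (w - u) < Re w - c" by (simp add: dist_norm)
    then show "u \<in> {w. c < Re w}" using complex_Re_le_cmod[of "w - u"] by simp
  qed
  show "F holomorphic_on ball w (Re w - c)" using log_hol sub holomorphic_on_subset by blast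
  have "inj_on \<Phi> (ball w (Re w - c))" using inj sub inj_on_subset by blast
  then show "inj_on (\<lambda>u. exp (F u)) (ball w (Re w - c))"
    using sub exp_log by (subst inj_on_cong[of _ _ \<Phi>]) auto
qed (use w in simp)

lemma has_field_derivative_log:
  "c < Re w \<Longrightarrow> (F has_field_derivative deriv F w) (at w within S)"
  using holomorphic_derivI[OF log_hol open_halfspace_Re_gt] by simp

lemma log_lipschitz:
  assumes "0 < m" "c + m \<le> Re u" "c + m \<le> Re v"
  shows "norm (F u - F v) \<le> 12 * pi / m * norm (u - v)"
proof (rule field_differentiable_bound[of "{w. c + m \<le> Re w}"])
  show "convex {w. c + m \<le> Re w}" using convex_halfspace_Re_ge[of "c + m"] by simp
  fix w assume w: "w \<in> {w. c + m \<le> Re w}"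
  then show "(F has_field_derivative deriv F w) (at w within {w. c + m \<le> Re w})"
    using has_field_derivative_log \<open>0 < m\<close> by simp
  have "norm (deriv F w) \<le> 12 * pi / (Re w - c)" using deriv_log_bound w \<open>0 < m\<close> by simp
  also have "\<dots> \<le> 12 * pi / m" using w \<open>0 < m\<close> by (intro divide_left_mono) auto
  finally show "norm (deriv F w) \<le> 12 * pi / m" .
qed (use assms in auto)

text \<open>
  From \<open>x1 = c + 24 \<pi>\<close> on the derivative of \<open>F\<close> is at most \<open>1/2\<close>, so that \<open>F\<close> falls behind the
  identity.  This is what makes slow escape possible: large moduli of \<open>f\<close> are attained in the tract at
  points of no larger modulus.
\<close>

lemma log_eventually_below_diagonal:
  obtains A where "\<And>x. A \<le> x \<Longrightarrow> Re (F (of_real x)) \<le> x"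
proof
  define x1 where "x1 = c + 24 * pi"
  fix x assume x: "max x1 (2 * Re (F (of_real x1)) - x1) \<le> x"
  have "norm (F (of_real x) - F (of_real x1)) \<le> 12 * pi / (24 * pi) * norm (of_real x - complex_of_real x1)"
    using x by (intro log_lipschitz) (auto simp: x1_def)
  also have "\<dots> = (x - x1) / 2"
    using x by (simp add: norm_of_real flip: of_real_diff)
  finally have "Re (F (of_real x)) - Re (F (of_real x1)) \<le> (x - x1) / 2"
    using complex_Re_le_cmod[of "F (of_real x) - F (of_real x1)"] by simp
  then show "Re (F (of_real x)) \<le> x" using x by simp
qed

lemma vertical_line_hits_level:
  assumes t: "c < t" and s: "Re (F (of_real t)) \<le> s"
  obtains y where "Re (F (Complex t y)) = s"
proof -
  obtain Y where Y: "0 \<le> Y" "exp s < norm (\<Phi> (Complex t Y))"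
    using level_unbounded[OF t] by blast
  have "norm (\<Phi> (Complex t Y)) = exp (Re (F (Complex t Y)))"
    using exp_log[of "Complex t Y"] t by (metis complex.sel(1) norm_exp_eq_Re)
  then have sY: "s \<le> Re (F (Complex t Y))" using Y by simp
  have "continuous_on {w. c < Re w} F" using log_hol holomorphic_on_imp_continuous_on by blast
  then have "continuous_on {0..Y} (\<lambda>y. F (Complex t y))"
    by (rule continuous_on_compose2) (use t in \<open>auto simp: Complex_eq intro!: continuous_intros\<close>)
  then have "continuous_on {0..Y} (\<lambda>y. Re (F (Complex t y)))"
    by (intro continuous_intros)
  moreover have "Re (F (Complex t 0)) \<le> s" using s by (simp add: complex_of_real_def)
  ultimately show ?thesis
    using IVT'[of "\<lambda>y. Re (F (Complex t y))" 0 s Y] sY Y that by blast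
qed

text \<open>
  The rectangle \<open>Q (n + 1)\<close> is placed at a height where \<open>Re F\<close> takes the value \<open>\<alpha> n + 1\<close>, the midpoint of
  \<open>[\<alpha> n, \<alpha> n + 2]\<close>, at its lower left corner.  This is possible because
  \<open>Re (F (\<alpha> (n + 1))) \<le> \<alpha> (n + 1) \<le> \<alpha> n + 1\<close>.
\<close>

lemma orbit_with_prescribed_growth:
  obtains A where "c + 24 * pi \<le> A"
    "\<And>\<alpha>. (\<And>n. A \<le> \<alpha> n) \<Longrightarrow> (\<And>n. \<alpha> (Suc n) \<le> \<alpha> n + 1) \<Longrightarrow>
      \<exists>\<zeta> w. \<forall>n. (f ^^ n) \<zeta> = \<Phi> (w n) \<and> \<alpha> n \<le> Re (w n) \<and> Re (w n) \<le> \<alpha> n + 2"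
proof -
  obtain A0 where A0: "\<And>x. A0 \<le> x \<Longrightarrow> Re (F (of_real x)) \<le> x"
    using log_eventually_below_diagonal by blast
  \<comment> \<open>At distance at least \<open>m\<close> from the boundary line, \<open>F\<close> varies by at most \<open>1\<close> on a rectangle whose
    side lengths add up to \<open>2 + 2 \<pi>\<close>.\<close>
  define m where "m = 12 * pi * (2 + 2 * pi)"
  have m: "24 * pi \<le> m" "0 < m"
    unfolding m_def using pi_gt_zero by (simp_all add: algebra_simps add_pos_pos)
  have "\<exists>\<zeta> w. \<forall>n. (f ^^ n) \<zeta> = \<Phi> (w n) \<and> \<alpha> n \<le> Re (w n) \<and> Re (w n) \<le> \<alpha> n + 2"
    if ge: "\<And>n. max A0 (c + m) \<le> \<alpha> n" and step: "\<And>n. \<alpha> (Suc n) \<le> \<alpha> n + 1" for \<alpha>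
  proof -
    have cm: "c + m \<le> \<alpha> n" "c < \<alpha> n" for n using ge[of n] m pi_gt_zero by linarith+
    have "\<exists>y. Re (F (Complex (\<alpha> (Suc n)) y)) = \<alpha> n + 1" for n
    proof -
      have "Re (F (of_real (\<alpha> (Suc n)))) \<le> \<alpha> n + 1"
        using A0[of "\<alpha> (Suc n)"] ge[of "Suc n"] step[of n] by linarith
      then show ?thesis using vertical_line_hits_level cm(2) by metis
    qed
    then obtain \<eta> where \<eta>: "\<And>n. Re (F (Complex (\<alpha> (Suc n)) (\<eta> n))) = \<alpha> n + 1" by metis
    define y where "y n = \<eta> (n - 1)" for n
    have y: "Re (F (Complex (\<alpha> (Suc n)) (y (Suc n)))) = \<alpha> n + 1" for n
      using \<eta> by (simp add: y_def)
    define Q where "Q n = cbox (Complex (\<alpha> n) (y n)) (Complex (\<alpha> n + 2) (y n + 2 * pi))" for n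
    have inQ: "w \<in> Q n \<longleftrightarrow> \<alpha> n \<le> Re w \<and> Re w \<le> \<alpha> n + 2 \<and> y n \<le> Im w \<and> Im w \<le> y n + 2 * pi" for w n
      by (auto simp: Q_def in_cbox_complex_iff)
    have "continuous_on {w. c < Re w} F" using log_hol holomorphic_on_imp_continuous_on by blast
    then have "continuous_on {w. c < Re w} (\<lambda>w. exp (F w))" by (intro continuous_intros)
    then have cont\<Phi>: "continuous_on {w. c < Re w} \<Phi>"
      by (rule continuous_on_eq) (simp add: exp_log)
    have QH: "Q n \<subseteq> {w. c < Re w}" for n using cm(2)[of n] by (auto simp: inQ)
    obtain \<zeta> where \<zeta>: "\<And>n. (f ^^ n) \<zeta> \<in> \<Phi> ` Q n"
    proof (rule exists_orbit_through_compact_sets[of f "\<lambda>n. \<Phi> ` Q n"])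
      show "continuous_on UNIV f" using entire holomorphic_on_imp_continuous_on by blast
      show "compact (\<Phi> ` Q n)" for n
        using continuous_on_subset[OF cont\<Phi> QH] by (intro compact_continuous_image) (auto simp: Q_def)
      show "\<Phi> ` Q n \<noteq> {}" for n
        using inQ[of "Complex (\<alpha> n) (y n)" n] pi_ge_zero by force
      fix n
      show "\<Phi> ` Q (Suc n) \<subseteq> f ` \<Phi> ` Q n"
      proof
        fix z assume "z \<in> \<Phi> ` Q (Suc n)"
        then obtain w where w: "w \<in> Q (Suc n)" "z = \<Phi> w" by blast
        define w0 where "w0 = Complex (\<alpha> (Suc n)) (y (Suc n))"
        have "norm (w - w0) \<le> \<bar>Re (w - w0)\<bar> + \<bar>Im (w - w0)\<bar>" by (rule cmod_le)
        also have "\<dots> \<le> 2 + 2 * pi" using w(1) by (auto simp: inQ w0_def)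
        finally have diam: "norm (w - w0) \<le> 2 + 2 * pi" .
        have "norm (F w - F w0) \<le> 12 * pi / m * norm (w - w0)"
          using m(2) w(1) cm(1)[of "Suc n"] by (intro log_lipschitz) (auto simp: inQ w0_def)
        also have "\<dots> \<le> 12 * pi / m * (2 + 2 * pi)"
          using diam m(2) by (intro mult_left_mono) auto
        also have "\<dots> = 1" using m(2) unfolding m_def by (simp only: times_divide_eq_left divide_self)
        finally have "\<bar>Re (F w) - (\<alpha> n + 1)\<bar> \<le> 1"
          using abs_Re_le_cmod[of "F w - F w0"] y[of n] by (simp add: w0_def)
        moreover obtain v where v: "exp v = exp (F w)" "Re v = Re (F w)" "y n \<le> Im v" "Im v \<le> y n + 2 * pi"
          using exp_preimage_in_strip by metis
        ultimately have vQ: "v \<in> Q n" by (auto simp: inQ)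
        have "f (\<Phi> v) = exp v" using semiconj QH[of n] vQ by blast
        also have "\<dots> = z" using v(1) w exp_log QH[of "Suc n"] by auto
        finally show "z \<in> f ` \<Phi> ` Q n" using vQ by blast
      qed
    qed (rule that)
    then have "\<forall>n. \<exists>w. w \<in> Q n \<and> (f ^^ n) \<zeta> = \<Phi> w" by blast
    then obtain w where "\<And>n. w n \<in> Q n \<and> (f ^^ n) \<zeta> = \<Phi> (w n)" by metis
    then show ?thesis by (auto simp: inQ)
  qed
  moreover have "c + 24 * pi \<le> max A0 (c + m)" using m by linarith
  ultimately show ?thesis using that by blast
qed

section \<open>Expansion and the Julia set\<close>

text \<open>
  Differentiating \<open>f (exp (F w)) = exp w\<close> expresses the logarithmic derivative of \<open>f\<close> as
  \<open>z f' z / f z = 1 / F' w\<close> at \<open>z = \<Phi> w\<close>, so the bound on \<open>F'\<close> from above becomes a bound on this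
  quantity from below.
\<close>

lemma expansion:
  assumes w: "c < Re w"
  shows "(Re w - c) / (12 * pi) * norm (f (\<Phi> w)) \<le> norm (deriv f (\<Phi> w)) * norm (\<Phi> w)"
proof -
  have "((\<lambda>u. exp (F u)) has_field_derivative exp (F w) * deriv F w) (at w)"
    using has_field_derivative_log[OF w] by (auto intro!: derivative_eq_intros)
  moreover have "(f has_field_derivative deriv f (\<Phi> w)) (at (exp (F w)))"
    using holomorphic_derivI[OF entire, of "\<Phi> w"] exp_log[OF w] by simp
  ultimately have "((\<lambda>u. f (exp (F u))) has_field_derivative deriv f (\<Phi> w) * (exp (F w) * deriv F w)) (at w)"
    by (rule DERIV_chain2[rotated])
  then have "(exp has_field_derivative deriv f (\<Phi> w) * (exp (F w) * deriv F w)) (at w)"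
    by (rule has_field_derivative_transform_within_open[OF _ open_halfspace_Re_gt[of c]])
      (use w semiconj exp_log in auto)
  then have "deriv f (\<Phi> w) * (\<Phi> w * deriv F w) = exp w"
    using DERIV_unique[OF _ DERIV_exp] exp_log[OF w] by auto
  then have "norm (f (\<Phi> w)) = norm (deriv f (\<Phi> w)) * norm (\<Phi> w) * norm (deriv F w)"
    using semiconj[OF w] by (metis mult.assoc norm_mult)
  also have "\<dots> \<le> norm (deriv f (\<Phi> w)) * norm (\<Phi> w) * (12 * pi / (Re w - c))"
    using deriv_log_bound[OF w] by (intro mult_left_mono) auto
  finally show ?thesis using w by (simp add: field_simps)
qed

text \<open>
  By the chain rule the logarithmic derivatives multiply along the orbit.  Each of the first \<open>n\<close>
  factors is estimated by \<open>2\<close>; the last one is kept, since the upper bound that it is compared with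
  also grows like \<open>ln |f^(n + 1) \<zeta>| = Re (w n)\<close>.
\<close>

lemma expansion_along_orbit:
  assumes orbit: "\<And>n. (f ^^ n) \<zeta> = \<Phi> (w n)" and far: "\<And>n. c + 24 * pi \<le> Re (w n)"
  shows "2 ^ n * (Re (w n) - c) / (12 * pi) * norm ((f ^^ Suc n) \<zeta>)
    \<le> norm (deriv (f ^^ Suc n) \<zeta>) * norm \<zeta>"
proof -
  have chain: "deriv (f ^^ Suc n) \<zeta> = deriv f (\<Phi> (w n)) * deriv (f ^^ n) \<zeta>" for n
  proof -
    have "(f ^^ n has_field_derivative deriv (f ^^ n) \<zeta>) (at \<zeta>)"
      using holomorphic_derivI[OF holomorphic_on_iterate[OF entire]] by simp
    moreover have "(f has_field_derivative deriv f (\<Phi> (w n))) (at ((f ^^ n) \<zeta>))"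
      using holomorphic_derivI[OF entire] orbit by simp
    ultimately have "(f \<circ> f ^^ n has_field_derivative deriv f (\<Phi> (w n)) * deriv (f ^^ n) \<zeta>) (at \<zeta>)"
      by (rule DERIV_chain[rotated])
    then show ?thesis using DERIV_imp_deriv by simp
  qed
  have step: "2 ^ n * (Re (w n) - c) / (12 * pi) * norm ((f ^^ Suc n) \<zeta>)
    \<le> norm (deriv (f ^^ Suc n) \<zeta>) * norm \<zeta>"
    if IH: "2 ^ n * norm ((f ^^ n) \<zeta>) \<le> norm (deriv (f ^^ n) \<zeta>) * norm \<zeta>" for n
  proof -
    have cw: "c < Re (w n)" using far[of n] pi_gt_zero by linarith
    have "2 ^ n * (Re (w n) - c) / (12 * pi) * norm ((f ^^ Suc n) \<zeta>)
      = 2 ^ n * ((Re (w n) - c) / (12 * pi) * norm (f (\<Phi> (w n))))"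
      using orbit[of n] by simp
    also have "\<dots> \<le> 2 ^ n * (norm (deriv f (\<Phi> (w n))) * norm (\<Phi> (w n)))"
      using expansion[OF cw] by (intro mult_left_mono) auto
    also have "\<dots> = norm (deriv f (\<Phi> (w n))) * (2 ^ n * norm ((f ^^ n) \<zeta>))"
      using orbit[of n] by simp
    also have "\<dots> \<le> norm (deriv f (\<Phi> (w n))) * (norm (deriv (f ^^ n) \<zeta>) * norm \<zeta>)"
      using IH by (intro mult_left_mono) auto
    also have "\<dots> = norm (deriv (f ^^ Suc n) \<zeta>) * norm \<zeta>"
      by (simp only: chain norm_mult mult.assoc)
    finally show ?thesis .
  qed
  have "2 ^ n * norm ((f ^^ n) \<zeta>) \<le> norm (deriv (f ^^ n) \<zeta>) * norm \<zeta>" for n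
  proof (induction n)
    case 0
    then show ?case by (simp add: id_def)
  next
    case (Suc n)
    have "2 \<le> (Re (w n) - c) / (12 * pi)" using far[of n] by (simp add: field_simps)
    then have "2 ^ n * 2 * norm ((f ^^ Suc n) \<zeta>) \<le> 2 ^ n * ((Re (w n) - c) / (12 * pi)) * norm ((f ^^ Suc n) \<zeta>)"
      by (intro mult_right_mono mult_left_mono) auto
    then show ?case using step[OF Suc] unfolding power_Suc times_divide_eq_right by linarith
  qed
  then show ?thesis using step by blast
qed

text \<open>
  An escaping point rules out a finite limit of the iterates.  If instead a subsequence tends to
  infinity uniformly on a disc of radius \<open>\<delta>\<close>, then an iterate \<open>G\<close> in it has a logarithm with positive
  real part there, and its logarithmic derivative at \<open>\<zeta>\<close> is at most \<open>2 ln |G \<zeta>| / \<delta>\<close>.  The expansion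
  along the orbit makes it larger than this for a late iterate.
\<close>

lemma escaping_orbit_in_julia_set:
  assumes orbit: "\<And>n. (f ^^ n) \<zeta> = \<Phi> (w n)" and far: "\<And>n. c + 24 * pi \<le> Re (w n)"
    and esc: "\<zeta> \<in> escaping_set f"
  shows "\<zeta> \<in> julia_set f"
proof -
  have "False" if fatou: "\<zeta> \<in> fatou_set f"
  proof -
    obtain U where U: "open U" "\<zeta> \<in> U" "normal_family_on U (range (\<lambda>n. f ^^ n))"
      using fatou unfolding fatou_set_def by auto
    obtain r :: "nat \<Rightarrow> nat" where r: "strict_mono r" and alt:
      "(\<exists>g. \<forall>K. compact K \<and> K \<subseteq> U \<longrightarrow> uniform_limit K (\<lambda>n. f ^^ r n) g sequentially) \<or>
       (\<forall>K. compact K \<and> K \<subseteq> U \<longrightarrow> (\<forall>B :: real. \<forall>\<^sub>F n in sequentially. \<forall>z\<in>K. B < norm ((f ^^ r n) z)))"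
      using U(3)[unfolded normal_family_on_def, rule_format, OF order_refl] by auto
    have inf: "filterlim (\<lambda>n. (f ^^ r n) \<zeta>) at_infinity sequentially"
      using esc by (intro filterlim_compose[OF _ filterlim_subseq[OF r]]) (simp add: escaping_set_def)
    from alt show False
    proof
      assume "\<exists>g. \<forall>K. compact K \<and> K \<subseteq> U \<longrightarrow> uniform_limit K (\<lambda>n. f ^^ r n) g sequentially"
      then obtain g where "uniform_limit {\<zeta>} (\<lambda>n. f ^^ r n) g sequentially"
        using U(2) by (metis compact_insert compact_empty empty_subsetI insert_subset)
      then have "(\<lambda>n. (f ^^ r n) \<zeta>) \<longlonglongrightarrow> g \<zeta>"
        by (rule tendsto_uniform_limitI) simp
      then show False
        using not_tendsto_and_filterlim_at_infinity[OF sequentially_bot _ inf] by blast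
    next
      assume *: "\<forall>K. compact K \<and> K \<subseteq> U \<longrightarrow>
        (\<forall>B :: real. \<forall>\<^sub>F n in sequentially. \<forall>z\<in>K. B < norm ((f ^^ r n) z))"
      obtain \<delta> where \<delta>: "0 < \<delta>" "cball \<zeta> \<delta> \<subseteq> U"
        using U open_contains_cball by blast
      then have ev1: "\<forall>\<^sub>F n in sequentially. \<forall>z\<in>cball \<zeta> \<delta>. 1 < norm ((f ^^ r n) z)"
        using *[rule_format, of "cball \<zeta> \<delta>" 1] by simp
      \<comment> \<open>This makes \<open>\<rho> - c \<ge> \<rho> / 2\<close> for \<open>\<rho> = ln |f^(r n) \<zeta>|\<close>.\<close>
      have ev2: "\<forall>\<^sub>F n in sequentially. exp (2 * c) \<le> norm ((f ^^ r n) \<zeta>)"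
        using inf unfolding filterlim_at_infinity[OF order_refl]
        by (rule allE[of _ "max 1 (exp (2 * c))"]) (auto elim: eventually_mono)
      \<comment> \<open>The value at which the lower bound \<open>2^j \<rho> / (24 \<pi>)\<close> equals the upper bound \<open>2 \<rho> |\<zeta>| / \<delta>\<close>.\<close>
      define M where "M = 48 * pi * norm \<zeta> / \<delta>"
      obtain J where J: "M < 2 ^ J" using real_arch_pow[of 2 M] by auto
      have ev3: "\<forall>\<^sub>F n in sequentially. Suc J \<le> r n"
        using filterlim_subseq[OF r] by (simp add: filterlim_at_top)
      obtain n where n: "\<forall>z\<in>cball \<zeta> \<delta>. 1 < norm ((f ^^ r n) z)"
        "exp (2 * c) \<le> norm ((f ^^ r n) \<zeta>)" "Suc J \<le> r n"
        using eventually_happens[OF eventually_conj[OF ev1 eventually_conj[OF ev2 ev3]]]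
        by auto
      obtain j where j: "r n = Suc j" "J \<le> j" using n(3) by (cases "r n") auto
      define G where "G = f ^^ r n"
      have Ghol: "G holomorphic_on ball \<zeta> \<delta>"
        unfolding G_def using holomorphic_on_iterate[OF entire] holomorphic_on_subset by blast
      have G1: "1 < norm (G z)" if "z \<in> ball \<zeta> \<delta>" for z
        using n(1) that by (auto simp: G_def)
      have "G z \<noteq> 0" if "z \<in> ball \<zeta> \<delta>" for z using G1[OF that] by auto
      then obtain h where h: "h holomorphic_on ball \<zeta> \<delta>" "\<And>z. z \<in> ball \<zeta> \<delta> \<Longrightarrow> G z = exp (h z)"
        using contractible_imp_holomorphic_log[OF Ghol convex_imp_contractible[OF convex_ball]] by blast
      have hpos: "0 < Re (h z)" if "z \<in> ball \<zeta> \<delta>" for z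
        using G1[OF that] h(2)[OF that] by simp
      have \<zeta>in: "\<zeta> \<in> ball \<zeta> \<delta>" using \<delta> by simp
      define \<rho> where "\<rho> = Re (h \<zeta>)"
      have \<rho>: "0 < \<rho>" using hpos \<zeta>in by (simp add: \<rho>_def)
      have cw: "c < Re (w j)" using far[of j] pi_gt_zero by linarith
      have "G \<zeta> = exp (w j)" using semiconj[OF cw] orbit[of j] j by (simp add: G_def)
      then have "exp (Re (w j)) = exp \<rho>"
        using h(2)[OF \<zeta>in] by (metis norm_exp_eq_Re \<rho>_def)
      then have w\<rho>: "Re (w j) = \<rho>" by simp
      have nG: "norm (G \<zeta>) = exp \<rho>" using h(2)[OF \<zeta>in] by (simp add: \<rho>_def)
      then have \<rho>c: "2 * c \<le> \<rho>" using n(2) by (simp add: G_def)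
      have "(h has_field_derivative deriv h \<zeta>) (at \<zeta>)"
        using holomorphic_derivI[OF h(1) open_ball \<zeta>in] .
      then have "((\<lambda>z. exp (h z)) has_field_derivative G \<zeta> * deriv h \<zeta>) (at \<zeta>)"
        using h(2)[OF \<zeta>in] by (auto intro!: derivative_eq_intros)
      then have "(G has_field_derivative G \<zeta> * deriv h \<zeta>) (at \<zeta>)"
        by (rule has_field_derivative_transform_within_open[OF _ open_ball \<zeta>in]) (simp add: h)
      then have "norm (deriv G \<zeta>) = exp \<rho> * norm (deriv h \<zeta>)"
        using DERIV_imp_deriv nG by (metis norm_mult)
      also have "\<dots> \<le> exp \<rho> * (2 * \<rho> / \<delta>)"
        using deriv_bound_right_half_plane[OF h(1) \<delta>(1) hpos] by (intro mult_left_mono) (auto simp: \<rho>_def)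
      finally have upper: "norm (deriv G \<zeta>) * norm \<zeta> \<le> exp \<rho> * (2 * \<rho> / \<delta>) * norm \<zeta>"
        by (intro mult_right_mono) auto
      have "2 ^ j * (\<rho> / 2) / (12 * pi) * exp \<rho> \<le> 2 ^ j * (\<rho> - c) / (12 * pi) * exp \<rho>"
        using \<rho>c by (intro mult_right_mono divide_right_mono mult_left_mono) auto
      also have "\<dots> \<le> norm (deriv G \<zeta>) * norm \<zeta>"
        using expansion_along_orbit[OF orbit far, of j] nG w\<rho> j by (simp add: G_def)
      also note upper
      finally have "exp \<rho> * \<rho> * 2 ^ j \<le> exp \<rho> * \<rho> * M"
        using \<delta> by (simp add: M_def field_simps)
      then have "2 ^ j \<le> M" using \<rho> by (simp add: mult_le_cancel_left)
      moreover have "(2::real) ^ J \<le> 2 ^ j" using j by (intro power_increasing) auto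
      ultimately show False using J by linarith
    qed
  qed
  then show ?thesis unfolding julia_set_def by blast
qed

end

section \<open>Slow escaping points in a logarithmic tract\<close>

theorem theorem1p1:
  fixes f :: "complex \<Rightarrow> complex" and D :: "complex set" and a :: "nat \<Rightarrow> real"
  assumes "transcendental_entire f"
    and "logarithmic_tract f D"
    and "\<And>n. 0 < a n"
    and "filterlim a at_top sequentially"
  shows "\<exists>\<zeta> \<in> escaping_set f \<inter> julia_set f \<inter> closure D. \<exists>N :: nat.
           (\<forall>n\<ge>1. (f ^^ n) \<zeta> \<in> closure D) \<and> (\<forall>n\<ge>N. norm ((f ^^ n) \<zeta>) \<le> a n)"
proof -
  have "f holomorphic_on UNIV" using assms(1) by (simp add: transcendental_entire_def)
  then obtain \<Phi> F c where "tract_coordinate f \<Phi> F c" and \<Phi>D: "\<And>w. c < Re w \<Longrightarrow> \<Phi> w \<in> D"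
    using logarithmic_tract_coordinate assms(2) by blast
  then interpret tract_coordinate f \<Phi> F c by blast
  obtain A where A: "c + 24 * pi \<le> A" and orb:
    "\<And>\<alpha>. (\<And>n. A \<le> \<alpha> n) \<Longrightarrow> (\<And>n. \<alpha> (Suc n) \<le> \<alpha> n + 1) \<Longrightarrow>
      \<exists>\<zeta> w. \<forall>n. (f ^^ n) \<zeta> = \<Phi> (w n) \<and> \<alpha> n \<le> Re (w n) \<and> Re (w n) \<le> \<alpha> n + 2"
    using orbit_with_prescribed_growth by blast
  \<comment> \<open>The iterate with index \<open>n + 1\<close> has modulus \<open>exp (Re (w n))\<close>, which is at most \<open>exp (\<alpha> n + 2)\<close>;
    hence the shift of index and the \<open>2\<close>.\<close>
  have "filterlim (\<lambda>n. ln (a (Suc n))) at_top sequentially"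
    using assms(4) by (intro filterlim_compose[OF ln_at_top]) (simp add: filterlim_sequentially_Suc)
  then have "filterlim (\<lambda>n. - 2 + ln (a (Suc n))) at_top sequentially"
    by (rule filterlim_tendsto_add_at_top[OF tendsto_const])
  then obtain \<alpha> :: "nat \<Rightarrow> real" where \<alpha>: "\<And>n. A \<le> \<alpha> n" "\<And>n. \<alpha> (Suc n) \<le> \<alpha> n + 1"
    "filterlim \<alpha> at_top sequentially" "\<forall>\<^sub>F n in sequentially. \<alpha> n \<le> - 2 + ln (a (Suc n))"
    by (rule slow_sequence_above_level[where A = A]) (rule that)
  obtain \<zeta> w where orbit: "\<And>n. (f ^^ n) \<zeta> = \<Phi> (w n)"
    and lo: "\<And>n. \<alpha> n \<le> Re (w n)" and hi: "\<And>n. Re (w n) \<le> \<alpha> n + 2"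
    using orb[of \<alpha>, OF \<alpha>(1,2)] by blast
  have far: "c + 24 * pi \<le> Re (w n)" for n using A \<alpha>(1)[of n] lo[of n] by linarith
  then have cw: "c < Re (w n)" for n using pi_gt_zero far[of n] by linarith
  have inD: "(f ^^ n) \<zeta> \<in> closure D" for n
    using \<Phi>D[OF cw] orbit closure_subset by fastforce
  have size: "norm ((f ^^ Suc n) \<zeta>) = exp (Re (w n))" for n
    using semiconj[OF cw] orbit[of n] by simp
  have "filterlim (\<lambda>n. Re (w n)) at_top sequentially"
    using filterlim_at_top_mono[OF \<alpha>(3)] lo by simp
  then have "filterlim (\<lambda>n. norm ((f ^^ Suc n) \<zeta>)) at_top sequentially"
    unfolding size by (rule filterlim_compose[OF exp_at_top])
  then have "filterlim (\<lambda>n. norm ((f ^^ n) \<zeta>)) at_top sequentially"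
    by (rule iffD1[OF filterlim_sequentially_Suc])
  then have esc: "\<zeta> \<in> escaping_set f"
    by (simp add: escaping_set_def filterlim_norm_at_top_imp_at_infinity)
  obtain N where N: "\<And>n. N \<le> n \<Longrightarrow> \<alpha> n \<le> - 2 + ln (a (Suc n))"
    using \<alpha>(4) by (auto simp: eventually_sequentially)
  have "norm ((f ^^ n) \<zeta>) \<le> a n" if late: "Suc N \<le> n" for n
  proof -
    obtain m where m: "n = Suc m" "N \<le> m" using late by (cases n) auto
    have "Re (w m) \<le> ln (a (Suc m))" using hi[of m] N[OF m(2)] by linarith
    then have "exp (Re (w m)) \<le> exp (ln (a (Suc m)))" by simp
    then show ?thesis using assms(3)[of "Suc m"] size[of m] m by simp
  qed
  moreover have "\<zeta> \<in> closure D" using inD[of 0] by simp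
  ultimately show ?thesis
    using esc escaping_orbit_in_julia_set[OF orbit far esc] inD by blast
qed

end
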